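(* Let $N\ge1$ be an integer, $a>0$, and let $P_n(x)$ and $g_N=g_N(x)$ be as in the context. For any $k\ge0$ and $j\ge1$, we have $$P_{k+jN}(x)=P_{k+N}(x)\,U_{j-1}(g_N)-P_k(x)\,U_{j-2}(g_N).$$ If $\theta=\arccos g_N$, then $$\frac{P_{k+jN}(x)}{P_k(x)}=\frac{\rho\sin(j\theta+\varphi)}{\sin\theta},$$ where $\rho>0$ and $\varphi\in[0,2\pi)$ are independent of $j=1,2,\ldots$ and satisfy $$\rho\cos\varphi=\frac{P_{k+N}(x)}{P_k(x)}-\cos\theta,\qquad \rho\sin\varphi=\sin\theta.$$
   Context: Let $q=e^{2\pi i/N}$, so $a(q^n+q^{-n})=2a\cos(2\pi n/N)$. The polynomials $P_n(x)$ are defined by $P_0(x)=1$, $P_1(x)=2x-2a$ and $$2xP_n(x)=P_{n+1}(x)+a(q^n+q^{-n})P_n(x)+P_{n-1}(x),\quad n\ge1.$$ The numerator polynomials $P_n^*(x)$ are defined by the same recurrence for $n\ge 1$ with $P_0^*(x)=0$ and $P_1^*(x)=2$. The polynomial $g_N$ is $$g_N(x)=\frac{P_N(x)-P_{N-1}^*(x)/2}{2}.$$ $U_n$ denotes the Chebyshev polynomial of the second kind, $U_0(x)=1$, $U_1(x)=2x$, $U_{n+1}(x)=2xU_n(x)-U_{n-1}(x)$, with the convention $U_{-1}=0$. *)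

theory Defs
  imports Complex_Main "HOL-Computational_Algebra.Polynomial"
begin

text \<open>
  The diagonal coefficient \<open>a (q\<^sup>n + q\<^sup>-\<^sup>n)\<close> with \<open>q = e\<^bsup>2 \<pi> i / N\<^esup>\<close>, in its real form;
  lemma \<open>diag_coeff_root_of_unity\<close> gives the form in terms of \<open>q\<close>.
\<close>
definition diag_coeff :: "real \<Rightarrow> nat \<Rightarrow> nat \<Rightarrow> real" where
  "diag_coeff a N n = 2 * a * cos (2 * pi * real n / real N)"

lemma diag_coeff_root_of_unity:
  fixes a :: real and N n :: nat
  defines "q \<equiv> exp (2 * of_real pi * \<i> / of_nat N) :: complex"
  shows "of_real (diag_coeff a N n) = of_real a * (q ^ n + inverse q ^ n)"
proof -
  have q: "q = cis (2 * pi / real N)"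
    unfolding q_def cis_conv_exp by (simp add: mult_ac)
  have "q ^ n = cis (2 * pi * real n / real N)"
    unfolding q by (simp add: Complex.DeMoivre mult_ac)
  moreover have "inverse q ^ n = cis (- (2 * pi * real n / real N))"
    unfolding q by (simp add: Complex.DeMoivre mult_ac)
  ultimately show ?thesis
    by (simp add: complex_eq_iff diag_coeff_def)
qed

fun P :: "real \<Rightarrow> nat \<Rightarrow> nat \<Rightarrow> real poly" where
  "P a N 0 = 1"
| "P a N (Suc 0) = [:- 2 * a, 2:]"
| "P a N (Suc (Suc n)) =
     [:- diag_coeff a N (Suc n), 2:] * P a N (Suc n) - P a N n"

lemma P_recurrence:
  assumes "n \<ge> 1"
  shows "[:0, 2:] * P a N n = P a N (n + 1) + smult (diag_coeff a N n) (P a N n) + P a N (n - 1)"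
  using assms by (cases n) simp_all

fun P_star :: "real \<Rightarrow> nat \<Rightarrow> nat \<Rightarrow> real poly" where
  "P_star a N 0 = 0"
| "P_star a N (Suc 0) = [:2:]"
| "P_star a N (Suc (Suc n)) =
     [:- diag_coeff a N (Suc n), 2:] * P_star a N (Suc n) - P_star a N n"

lemma P_star_recurrence:
  assumes "n \<ge> 1"
  shows "[:0, 2:] * P_star a N n =
    P_star a N (n + 1) + smult (diag_coeff a N n) (P_star a N n) + P_star a N (n - 1)"
  using assms by (cases n) simp_all

definition g :: "real \<Rightarrow> nat \<Rightarrow> real poly" where
  "g a N = smult (1 / 2) (P a N N - smult (1 / 2) (P_star a N (N - 1)))"

fun cheb_U_nat :: "nat \<Rightarrow> real poly" where
  "cheb_U_nat 0 = 1"
| "cheb_U_nat (Suc 0) = [:0, 2:]"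
| "cheb_U_nat (Suc (Suc n)) = [:0, 2:] * cheb_U_nat (Suc n) - cheb_U_nat n"

text \<open>Integer index, so that \<open>U\<^bsub>-1\<^esub> = 0\<close>; smaller indices are junk values.\<close>
definition U :: "int \<Rightarrow> real poly" where
  "U n = (if n < 0 then 0 else cheb_U_nat (nat n))"

end

theory Submission
  imports Defs
begin

text \<open>
  The diagonal coefficients are \<open>N\<close>-periodic, so the shifted sequence \<open>P\<^bsub>n+N\<^esub>\<close> solves the same
  three-term recurrence and is a combination of the solutions \<open>P\<^sub>n\<close> and \<open>P\<^sup>*\<^sub>n\<close>.  The monodromy
  matrix of the recurrence over one period has determinant \<open>1\<close> (Casorati) and trace \<open>2 g\<^sub>N\<close>, so by
  Cayley--Hamilton \<open>P\<^bsub>n+2N\<^esub> = 2 g\<^sub>N P\<^bsub>n+N\<^esub> - P\<^sub>n\<close>.  Along an arithmetic progression of step \<open>N\<close>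
  this is the Chebyshev recurrence, and the trigonometric form follows from
  \<open>U\<^bsub>j-1\<^esub>(cos \<theta>) = sin (j \<theta>) / sin \<theta>\<close>.
\<close>

lemma diag_coeff_add_period:
  assumes "N \<ge> 1"
  shows "diag_coeff a N (n + N) = diag_coeff a N n"
proof -
  have "2 * pi * real (n + N) / real N = 2 * pi * real n / real N + 2 * pi"
    using assms by (simp add: field_simps)
  then show ?thesis
    by (simp add: diag_coeff_def)
qed

lemma diag_coeff_0: "diag_coeff a N 0 = 2 * a"
  by (simp add: diag_coeff_def)

text \<open>\<open>w\<close> stands for the value of \<open>y\<close> at index -1. Running the
  recurrences backwards gives \<open>p\<close> the value 0 and \<open>s\<close> the value -2 there,
  which fixes the coefficients. The factor 2 avoids a division in the ring.\<close>

lemma three_term_recurrence_basis: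
  fixes y p s c :: "nat \<Rightarrow> 'a :: comm_ring_1"
  assumes p: "p 0 = 1" "p 1 = c 0" "\<And>n. p (Suc (Suc n)) = c (Suc n) * p (Suc n) - p n"
    and s: "s 0 = 0" "s 1 = 2" "\<And>n. s (Suc (Suc n)) = c (Suc n) * s (Suc n) - s n"
    and y: "y 1 = c 0 * y 0 - w" "\<And>n. y (Suc (Suc n)) = c (Suc n) * y (Suc n) - y n"
  shows "2 * y n = 2 * y 0 * p n - w * s n"
proof (induction n rule: induct_nat_012)
  case 0
  then show ?case by (simp add: p s)
next
  case 1
  have "2 * y 1 = 2 * y 0 * p 1 - w * s 1"
    unfolding p(2) s(2) y(1) by (simp add: algebra_simps)
  then show ?case by simp
next
  case (ge2 n)
  have "2 * y (Suc (Suc n)) = c (Suc n) * (2 * y (Suc n)) - 2 * y n"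
    by (simp add: y(2) algebra_simps)
  also have "\<dots> = 2 * y 0 * p (Suc (Suc n)) - w * s (Suc (Suc n))"
    unfolding ge2 p(3) s(3) by (simp add: algebra_simps)
  finally show ?case .
qed

text \<open>Shifting by a period keeps the coefficients, and \<open>y M\<close> becomes the value at
  index -1. The period is written \<open>Suc M\<close> to make this predecessor available. At the
  left end the coefficient is \<open>2 * a\<close>, matching the first-degree polynomial.\<close>

lemma recurrence_shift_period:
  assumes y: "\<And>n. n \<ge> M \<Longrightarrow> y (Suc (Suc n)) = [:- diag_coeff a (Suc M) (Suc n), 2:] * y (Suc n) - y n"
  shows "2 * y (n + Suc M) = 2 * y (Suc M) * P a (Suc M) n - y M * P_star a (Suc M) n"
proof -
  have "diag_coeff a (Suc M) (Suc (l + M)) = diag_coeff a (Suc M) l" for l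
    using diag_coeff_add_period[of "Suc M" a l] by simp
  then have step: "y (Suc (Suc (l + M))) = [:- diag_coeff a (Suc M) l, 2:] * y (Suc (l + M)) - y (l + M)"
    for l
    using y[of "l + M"] by simp
  have "2 * y (n + Suc M) = 2 * y (0 + Suc M) * P a (Suc M) n - y M * P_star a (Suc M) n"
  proof (rule three_term_recurrence_basis[where c = "\<lambda>n. [:- diag_coeff a (Suc M) n, 2:]"])
    show "y (1 + Suc M) = [:- diag_coeff a (Suc M) 0, 2:] * y (0 + Suc M) - y M"
      using step[of 0] by simp
    show "y (Suc (Suc l) + Suc M) =
        [:- diag_coeff a (Suc M) (Suc l), 2:] * y (Suc l + Suc M) - y (l + Suc M)" for l
      using step[of "Suc l"] by simp
  qed (simp_all add: diag_coeff_0 numeral_poly)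
  then show ?thesis by simp
qed

text \<open>In passing from \<open>n\<close> to \<open>Suc n\<close> the terms with the diagonal
  coefficient cancel, so the determinant keeps its value at 0.\<close>

lemma Casorati_P_P_star:
  "P a N n * P_star a N (Suc n) - P a N (Suc n) * P_star a N n = 2"
proof (induction n)
  case 0
  then show ?case by (simp add: numeral_poly)
next
  case (Suc n)
  define c where "c = [:- diag_coeff a N (Suc n), 2:]"
  have "P a N (Suc n) * P_star a N (Suc (Suc n)) - P a N (Suc (Suc n)) * P_star a N (Suc n) =
      P a N (Suc n) * (c * P_star a N (Suc n) - P_star a N n) -
      (c * P a N (Suc n) - P a N n) * P_star a N (Suc n)"
    by (simp add: c_def)
  also have "\<dots> = P a N n * P_star a N (Suc n) - P a N (Suc n) * P_star a N n"
    by (simp add: algebra_simps)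
  finally show ?case
    using Suc by simp
qed

lemma P_add_two_periods:
  assumes "N \<ge> 1"
  shows "P a N (n + 2 * N) = 2 * g a N * P a N (n + N) - P a N n"
proof -
  obtain M where N: "N = Suc M"
    using assms by (cases N) auto
  \<comment> \<open>In the basis \<open>P\<close>, \<open>P_star\<close> the shift by
    \<open>N\<close> has rows \<open>(A, -C/2)\<close> and \<open>(D, -B/2)\<close>: determinant
    \<open>(C * D - A * B) / 2\<close> and trace \<open>A - B / 2\<close>.\<close>
  define A B C D where "A = P a N N" and "B = P_star a N M" and "C = P a N M" and "D = P_star a N N"
  have P_shift: "2 * P a N (l + N) = 2 * A * P a N l - C * P_star a N l" for l
    unfolding N A_def C_def by (rule recurrence_shift_period) simp
  have P_star_shift: "2 * P_star a N (l + N) = 2 * D * P a N l - B * P_star a N l" for l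
    unfolding N B_def D_def by (rule recurrence_shift_period) simp
  have det: "C * D - A * B = 2"
    using Casorati_P_P_star[of a N M] by (simp add: A_def B_def C_def D_def N)
  have "4 * g a N = smult 4 (g a N)"
    by (simp add: numeral_poly)
  then have trace: "2 * A - B = 4 * g a N"
    by (simp add: g_def A_def B_def N numeral_poly smult_diff_right)
  have "n + 2 * N = (n + N) + N"
    by simp
  then have "4 * P a N (n + 2 * N) = 2 * (2 * P a N ((n + N) + N))"
    by (simp only: mult.assoc[symmetric])
  also have "\<dots> = 4 * A * P a N (n + N) - C * (2 * P_star a N (n + N))"
    by (simp only: P_shift) (simp add: algebra_simps)
  also have "\<dots> = 4 * A * P a N (n + N) - 2 * C * D * P a N n + B * (C * P_star a N n)"
    by (simp only: P_star_shift) (simp add: algebra_simps)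
  \<comment> \<open>Reading the shift relation backwards eliminates \<open>P_star\<close>, so only
    trace and determinant remain.\<close>
  also have "C * P_star a N n = 2 * A * P a N n - 2 * P a N (n + N)"
    by (simp add: P_shift)
  also have "4 * A * P a N (n + N) - 2 * C * D * P a N n +
      B * (2 * A * P a N n - 2 * P a N (n + N)) =
      2 * (2 * A - B) * P a N (n + N) - 2 * (C * D - A * B) * P a N n"
    by (simp add: algebra_simps)
  also have "\<dots> = 4 * (2 * g a N * P a N (n + N) - P a N n)"
    unfolding det trace by (simp add: algebra_simps)
  finally show ?thesis
    by simp
qed

text \<open>The convention that \<open>U\<close> vanishes at -1 covers \<open>n = 0\<close>. At
  \<open>n = -1\<close> the identity fails, as the junk value at -2 is 0 instead of -1.\<close>

lemma U_rec:
  assumes "n \<ge> 0"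
  shows "U (n + 1) = [:0, 2:] * U n - U (n - 1)"
proof -
  obtain m where "n = int m"
    using assms nonneg_int_cases by blast
  then show ?thesis
    by (cases m) (simp_all add: U_def nat_add_distrib)
qed

lemma pcompose_U_rec:
  assumes "n \<ge> 0"
  shows "pcompose (U (n + 1)) p = 2 * p * pcompose (U n) p - pcompose (U (n - 1)) p"
proof -
  have "pcompose [:0, 2:] p = 2 * p"
    by (simp add: pcompose_pCons numeral_poly)
  then show ?thesis
    by (simp only: U_rec[OF assms] pcompose_diff pcompose_mult)
qed

text \<open>Both composed sequences solve the recurrence of \<open>f\<close>, so two initial values
  decide. Starting at \<open>Suc j\<close> keeps the indices of \<open>U\<close> at -1 or
  above.\<close>

lemma Chebyshev_recurrence_solution:
  fixes f :: "nat \<Rightarrow> real poly"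
  assumes rec: "\<And>j. f (Suc (Suc j)) = 2 * p * f (Suc j) - f j"
  shows "f (Suc j) = f 1 * pcompose (U (int j)) p - f 0 * pcompose (U (int j - 1)) p"
proof (induction j rule: induct_nat_012)
  case 0
  then show ?case by (simp add: U_def pcompose_1)
next
  case 1
  show ?case
    using rec[of 0] by (simp add: U_def pcompose_pCons pcompose_1 numeral_poly mult.commute)
next
  case (ge2 j)
  have U: "pcompose (U (int (Suc (Suc j)))) p =
      2 * p * pcompose (U (int (Suc j))) p - pcompose (U (int j)) p"
    "pcompose (U (int (Suc (Suc j)) - 1)) p =
      2 * p * pcompose (U (int j)) p - pcompose (U (int j - 1)) p"
    "int (Suc j) - 1 = int j"
    using pcompose_U_rec[of "int (Suc j)" p] pcompose_U_rec[of "int j" p]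
    by (simp_all add: add.commute)
  show ?case
    unfolding rec[of "Suc j"] ge2 U by (simp add: algebra_simps)
qed

text \<open>Both sides satisfy the recurrence with factor \<open>2 * cos \<theta>\<close>. The
  undivided form also covers \<open>sin \<theta> = 0\<close>.\<close>

lemma sin_mult_U_cos:
  "sin \<theta> * poly (U (int j - 1)) (cos \<theta>) = sin (real j * \<theta>)"
proof (induction j rule: induct_nat_012)
  case 0
  then show ?case by (simp add: U_def)
next
  case 1
  then show ?case by (simp add: U_def)
next
  case (ge2 j)
  have rec: "poly (U (int (Suc (Suc j)) - 1)) (cos \<theta>) =
      2 * cos \<theta> * poly (U (int (Suc j) - 1)) (cos \<theta>) - poly (U (int j - 1)) (cos \<theta>)"
    using arg_cong[OF U_rec[of "int j"], of "\<lambda>p. poly p (cos \<theta>)"] by (simp add: algebra_simps)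
  have sins: "sin (real (Suc (Suc j)) * \<theta>) + sin (real j * \<theta>) =
      2 * cos \<theta> * sin (real (Suc j) * \<theta>)"
    using sin_add[of "real (Suc j) * \<theta>" \<theta>] sin_diff[of "real (Suc j) * \<theta>" \<theta>]
    by (simp add: algebra_simps)
  have "sin \<theta> * poly (U (int (Suc (Suc j)) - 1)) (cos \<theta>) =
      2 * cos \<theta> * (sin \<theta> * poly (U (int (Suc j) - 1)) (cos \<theta>)) -
      sin \<theta> * poly (U (int j - 1)) (cos \<theta>)"
    unfolding rec by (simp only: right_diff_distrib mult.left_commute mult.assoc)
  also have "\<dots> = sin (real (Suc (Suc j)) * \<theta>)"
    unfolding ge2 using sins by simp
  finally show ?case .
qed

text \<open>Dividing by the radius, positive since \<open>v\<close> is nonzero, gives a point of the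
  unit circle.\<close>

lemma polar_coordinates_ex:
  fixes u v :: real
  assumes "v \<noteq> 0"
  shows "\<exists>\<rho> \<phi>. \<rho> > 0 \<and> 0 \<le> \<phi> \<and> \<phi> < 2 * pi \<and> \<rho> * cos \<phi> = u \<and> \<rho> * sin \<phi> = v"
proof -
  define \<rho> where "\<rho> = sqrt (u\<^sup>2 + v\<^sup>2)"
  have pos: "u\<^sup>2 + v\<^sup>2 > 0"
    using assms by (simp add: sum_power2_gt_zero_iff)
  then have \<rho>: "\<rho> > 0" "\<rho>\<^sup>2 = u\<^sup>2 + v\<^sup>2"
    by (simp_all add: \<rho>_def)
  then have "(u / \<rho>)\<^sup>2 + (v / \<rho>)\<^sup>2 = 1"
    using pos by (metis add_divide_distrib divide_self less_irrefl power_divide)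
  then obtain \<phi> where "0 \<le> \<phi>" "\<phi> < 2 * pi" "u / \<rho> = cos \<phi>" "v / \<rho> = sin \<phi>"
    by (rule sincos_total_2pi)
  then show ?thesis
    using \<rho>(1) by (intro exI[of _ \<rho>] exI[of _ \<phi>]) (auto simp: field_simps)
qed

lemma P_add_periods_eq_U:
  assumes "N \<ge> 1" and "j \<ge> 1"
  shows "P a N (k + j * N) =
    P a N (k + N) * pcompose (U (int j - 1)) (g a N) - P a N k * pcompose (U (int j - 2)) (g a N)"
proof -
  obtain i where j: "j = Suc i"
    using assms(2) by (cases j) auto
  have "P a N (k + Suc (Suc l) * N) = 2 * g a N * P a N (k + Suc l * N) - P a N (k + l * N)" for l
    using P_add_two_periods[OF assms(1), of a "k + l * N"]
    by (simp only: add.assoc mult_2 mult_Suc add.commute[of N "l * N"] add.left_commute[of N "l * N"])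
  then show ?thesis
    using Chebyshev_recurrence_solution[of "\<lambda>l. P a N (k + l * N)" "g a N" i] by (simp add: j)
qed

theorem theorem3p1:
  fixes N k :: nat and a :: real
  assumes "N \<ge> 1" and "a > 0"
  shows "(\<forall>j::nat. j \<ge> 1 \<longrightarrow>
            P a N (k + j * N) =
              P a N (k + N) * pcompose (U (int j - 1)) (g a N)
              - P a N k * pcompose (U (int j - 2)) (g a N))
       \<and> (\<forall>x \<theta> :: real.
            - 1 < poly (g a N) x \<and> poly (g a N) x < 1 \<and> poly (P a N k) x \<noteq> 0 \<and>
            \<theta> = arccos (poly (g a N) x) \<longrightarrow>
            (\<exists>\<rho> \<phi> :: real. \<rho> > 0 \<and> 0 \<le> \<phi> \<and> \<phi> < 2 * pi \<and>
               \<rho> * cos \<phi> = poly (P a N (k + N)) x / poly (P a N k) x - cos \<theta> \<and>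
               \<rho> * sin \<phi> = sin \<theta> \<and>
               (\<forall>j::nat. j \<ge> 1 \<longrightarrow>
                  poly (P a N (k + j * N)) x / poly (P a N k) x =
                    \<rho> * sin (real j * \<theta> + \<phi>) / sin \<theta>)))"
proof (intro conjI allI impI)
  show "P a N (k + j * N) =
      P a N (k + N) * pcompose (U (int j - 1)) (g a N)
      - P a N k * pcompose (U (int j - 2)) (g a N)" if "j \<ge> 1" for j
    using assms(1) that by (rule P_add_periods_eq_U)
next
  fix x \<theta> :: real
  assume *: "- 1 < poly (g a N) x \<and> poly (g a N) x < 1 \<and> poly (P a N k) x \<noteq> 0 \<and>
    \<theta> = arccos (poly (g a N) x)"
  define r where "r = poly (P a N (k + N)) x / poly (P a N k) x"
  have cos: "cos \<theta> = poly (g a N) x"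
    using * by simp
  \<comment> \<open>The strict bounds on \<open>g a N\<close> at \<open>x\<close> exclude the
    endpoints, where the sine would vanish.\<close>
  have "0 < \<theta>" "\<theta> < pi"
    using * arccos_lt_bounded by auto
  then have sin: "sin \<theta> > 0"
    by (rule sin_gt_zero)
  \<comment> \<open>Amplitude and phase are chosen before \<open>j\<close> is introduced, hence do
    not depend on it.\<close>
  then obtain \<rho> \<phi> where \<rho>: "\<rho> > 0" "0 \<le> \<phi>" "\<phi> < 2 * pi"
      "\<rho> * cos \<phi> = r - cos \<theta>" "\<rho> * sin \<phi> = sin \<theta>"
    using polar_coordinates_ex[of "sin \<theta>" "r - cos \<theta>"] by auto
  have "poly (P a N (k + j * N)) x / poly (P a N k) x = \<rho> * sin (real j * \<theta> + \<phi>) / sin \<theta>"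
    if "j \<ge> 1" for j
  proof -
    define u v where "u = poly (U (int j - 1)) (cos \<theta>)" and "v = poly (U (int j - 2)) (cos \<theta>)"
    have quot: "poly (P a N (k + j * N)) x / poly (P a N k) x = r * u - v"
      using * by (simp add: P_add_periods_eq_U[OF assms(1) that] poly_pcompose r_def u_def v_def
          cos diff_divide_distrib)
    have "sin \<theta> * u = sin (real j * \<theta>)"
      unfolding u_def by (rule sin_mult_U_cos)
    \<comment> \<open>As \<open>j \<ge> 1\<close>, the natural number \<open>j - 1\<close> is not
      truncated; for \<open>j = 1\<close> both sides are 0.\<close>
    moreover have "sin \<theta> * v = sin (real j * \<theta> - \<theta>)"
      using sin_mult_U_cos[of \<theta> "j - 1"] that by (simp add: v_def algebra_simps)
    ultimately have "sin \<theta> * (r * u - v) =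
        (r - cos \<theta>) * sin (real j * \<theta>) + sin \<theta> * cos (real j * \<theta>)"
      by (simp add: sin_diff algebra_simps)
    \<comment> \<open>The coefficients are \<open>\<rho> * cos \<phi>\<close> and
      \<open>\<rho> * sin \<phi>\<close>, so this is the addition formula for the sine.\<close>
    also have "\<dots> = \<rho> * sin (real j * \<theta> + \<phi>)"
      by (simp add: sin_add algebra_simps flip: \<rho>(4,5))
    finally have "sin \<theta> * (r * u - v) = \<rho> * sin (real j * \<theta> + \<phi>)" .
    then have "r * u - v = \<rho> * sin (real j * \<theta> + \<phi>) / sin \<theta>"
      using sin by (simp add: field_simps)
    with quot show ?thesis
      by simp
  qed
  with \<rho> show "\<exists>\<rho> \<phi> :: real. \<rho> > 0 \<and> 0 \<le> \<phi> \<and> \<phi> < 2 * pi \<and>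
      \<rho> * cos \<phi> = poly (P a N (k + N)) x / poly (P a N k) x - cos \<theta> \<and>
      \<rho> * sin \<phi> = sin \<theta> \<and>
      (\<forall>j::nat. j \<ge> 1 \<longrightarrow>
         poly (P a N (k + j * N)) x / poly (P a N k) x =
           \<rho> * sin (real j * \<theta> + \<phi>) / sin \<theta>)"
    unfolding r_def by blast
qed

end
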